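(* Let $k$ be an algebraically closed field of characteristic $0$, let $n\ge 1$, and let $\Sigma_n$ (with its quotient topology) and the $k$-algebra $\mathcal A$ of functions $\Sigma_n\to k$ be as defined in the context. Then: (1) for every $F\in\mathcal A$, the zero set of $F$ is closed in $\Sigma_n$; (2) for every closed $C\subseteq\Sigma_n$ there exists $\mathcal B\subseteq\mathcal A$ such that $C$ is the (common) zero set of $\mathcal B$ in $\Sigma_n$.
   Context: For $A,B\subseteq k$, $A\le_p B$ means that there is a polynomial $P\in k[X]$ with $A=P^{-1}(B)$; $A\equiv_p B$ means $A\le_p B$ and $B\le_p A$; $[A]$ is the $\equiv_p$-class of $A$. $\mathcal P_n$ is the set of $n$-element subsets of $k$, and $\Sigma_n=\{[A]\mid A\in\mathcal P_n\}$. Two elements of $\mathcal P_n$ are $\equiv_p$-equivalent if and only if one is the image of the other under a linear polynomial $cX+c'$ with $c\neq 0$; thus $\Sigma_n$ is the orbit space of the action $\alpha(P,A)=P(A)$ on $\mathcal P_n$ of the group $\mathcal L$ (under composition) of linear polynomials. Let $f_n=\prod_{j\ne j'}(X_j-X_{j'})\in k[X_1,\ldots,X_n]$ and let $D(f_n)\subseteq k^n$ be the open set of points with pairwise distinct coordinates; it is an affine variety with ring of regular functions $k[X_1,\ldots,X_n]_{f_n}$. $\mathcal P_n$ is identified with the quotient of $D(f_n)$ by the symmetric group $Sym_n$ permuting coordinates, with projection $\theta:D(f_n)\to\mathcal P_n$, $(a_1,\ldots,a_n)\mapsto\{a_1,\ldots,a_n\}$, the quotient topology, and ring of regular functions $\Gamma(\mathcal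 P_n)$ consisting of the functions $F(\{a_1,\ldots,a_n\})=\frac{g(a_1,\ldots,a_n)}{(f_n(a_1,\ldots,a_n))^r}$ with $g\in k[X_1,\ldots,X_n]$ symmetric and $r\in\mathbb N$. $\Sigma_n$ carries the quotient topology with respect to the projection $\theta':\mathcal P_n\to\Sigma_n$, $A\mapsto[A]$. $\mathcal A$ is the $k$-algebra of those $F\in\Gamma(\mathcal P_n)$ that are invariant under $\alpha$, i.e. $F(P(A))=F(A)$ for all $P\in\mathcal L$ and $A\in\mathcal P_n$; its elements are regarded as functions $\Sigma_n\to k$. *)

theory Defs
  imports
    "HOL-Analysis.Abstract_Topology"
    "HOL-Library.Poly_Mapping"
    "HOL-Library.FuncSet"
    "HOL-Combinatorics.Permutations"
    "HOL-Computational_Algebra.Polynomial"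
begin

definition poly_reducible :: "'a::field set \<Rightarrow> 'a set \<Rightarrow> bool" (infix \<open>\<le>\<^sub>p\<close> 50) where
  "A \<le>\<^sub>p B \<longleftrightarrow> (\<exists>P. A = poly P -` B)"

definition poly_equiv :: "'a::field set \<Rightarrow> 'a set \<Rightarrow> bool" (infix \<open>\<equiv>\<^sub>p\<close> 50) where
  "A \<equiv>\<^sub>p B \<longleftrightarrow> A \<le>\<^sub>p B \<and> B \<le>\<^sub>p A"

definition poly_class :: "'a::field set \<Rightarrow> 'a set set" where
  "poly_class A = {B. A \<equiv>\<^sub>p B}"

definition nsets :: "nat \<Rightarrow> 'a set set" where
  "nsets n = {A. finite A \<and> card A = n}"

definition Sigma_n :: "nat \<Rightarrow> 'a::field set set set" where
  "Sigma_n n = poly_class ` nsets n"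

definition linear_polys :: "'a::field poly set" where
  "linear_polys = {[:c', c:] | c c'. c \<noteq> 0}"

lemma linear_polys_eq: "linear_polys = {P. degree P = 1}"
proof -
  have "P \<in> linear_polys" if "degree P = 1" for P :: "'a poly"
  proof -
    obtain c' Q where P: "P = pCons c' Q" by (cases P)
    with that have "degree Q = 0" "Q \<noteq> 0" by (auto split: if_splits)
    then obtain c where "Q = [:c:]" "c \<noteq> 0" by (auto elim: degree_eq_zeroE)
    with P show ?thesis by (auto simp: linear_polys_def)
  qed
  then show ?thesis by (auto simp: linear_polys_def)
qed

lemma poly_reducible_refl: "A \<le>\<^sub>p A"
  unfolding poly_reducible_def by (intro exI[of _ "[:0, 1:]"]) auto

lemma poly_reducible_trans: "A \<le>\<^sub>p B \<Longrightarrow> B \<le>\<^sub>p C \<Longrightarrow> A \<le>\<^sub>p C"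
proof -
  assume "A \<le>\<^sub>p B" "B \<le>\<^sub>p C"
  then obtain P Q where "A = poly P -` B" "B = poly Q -` C"
    unfolding poly_reducible_def by blast
  then have "A = poly (pcompose Q P) -` C"
    by (auto simp: poly_pcompose)
  then show ?thesis unfolding poly_reducible_def by blast
qed

lemma equivp_poly_equiv: "equivp (\<equiv>\<^sub>p)"
  by (rule equivpI)
     (auto simp: reflp_def symp_def transp_def poly_equiv_def
           intro: poly_reducible_refl poly_reducible_trans)

lemma poly_class_eq_iff: "poly_class A = poly_class B \<longleftrightarrow> A \<equiv>\<^sub>p B"
  using equivp_poly_equiv unfolding poly_class_def equivp_def by auto

text \<open>The ring of polynomials in countably many variables with coefficients in the field, given by
  finitely supported maps from exponent vectors to coefficients (multiplication is convolution).
  Variables are numbered from \<open>0\<close>, so \<open>polys n\<close> is the ring in the variables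
  \<open>X 0, \<dots>, X (n - 1)\<close>.\<close>

type_synonym 'a mpoly = "(nat \<Rightarrow>\<^sub>0 nat) \<Rightarrow>\<^sub>0 'a"

definition polys :: "nat \<Rightarrow> 'a::field mpoly set" where
  "polys n = {p. \<forall>m \<in> Poly_Mapping.keys p. Poly_Mapping.keys m \<subseteq> {..<n}}"

definition mvar :: "nat \<Rightarrow> 'a::field mpoly" where
  "mvar i = Poly_Mapping.single (Poly_Mapping.single i 1) 1"

definition monom_eval :: "(nat \<Rightarrow>\<^sub>0 nat) \<Rightarrow> (nat \<Rightarrow> 'a::field) \<Rightarrow> 'a" where
  "monom_eval m a = (\<Prod>i \<in> Poly_Mapping.keys m. a i ^ Poly_Mapping.lookup m i)"

definition mpoly_eval :: "'a::field mpoly \<Rightarrow> (nat \<Rightarrow> 'a) \<Rightarrow> 'a" where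
  "mpoly_eval p a =
    (\<Sum>m \<in> Poly_Mapping.keys p. Poly_Mapping.lookup p m * monom_eval m a)"

text \<open>\<open>Poly_Mapping.map_key \<pi> m\<close> is the exponent vector \<open>m \<circ> \<pi>\<close>.\<close>

definition symmetric_poly :: "nat \<Rightarrow> 'a::field mpoly \<Rightarrow> bool" where
  "symmetric_poly n p \<longleftrightarrow>
    (\<forall>\<pi> m. \<pi> permutes {..<n} \<longrightarrow>
      Poly_Mapping.lookup p (Poly_Mapping.map_key \<pi> m) = Poly_Mapping.lookup p m)"

definition disc_poly :: "nat \<Rightarrow> 'a::field mpoly" where
  "disc_poly n =
    (\<Prod>(j, j') \<in> {(j, j'). j < n \<and> j' < n \<and> j \<noteq> j'}. mvar j - mvar j')"

lemma monom_eval_superset: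
  assumes "finite S" "Poly_Mapping.keys m \<subseteq> S"
  shows "monom_eval m a = (\<Prod>i\<in>S. a i ^ Poly_Mapping.lookup m i)"
  unfolding monom_eval_def
  by (rule prod.mono_neutral_left) (use assms in \<open>auto simp: in_keys_iff\<close>)

lemma monom_eval_0 [simp]: "monom_eval 0 a = 1"
  by (simp add: monom_eval_def)

lemma monom_eval_add: "monom_eval (m + m') a = monom_eval m a * monom_eval m' a"
proof -
  let ?S = "Poly_Mapping.keys m \<union> Poly_Mapping.keys m'"
  have "monom_eval (m + m') a = (\<Prod>i\<in>?S. a i ^ Poly_Mapping.lookup (m + m') i)"
    by (rule monom_eval_superset) (use keys_add[of m m'] in auto)
  also have "\<dots> = (\<Prod>i\<in>?S. a i ^ Poly_Mapping.lookup m i) *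
                  (\<Prod>i\<in>?S. a i ^ Poly_Mapping.lookup m' i)"
    by (simp add: lookup_add power_add prod.distrib)
  also have "\<dots> = monom_eval m a * monom_eval m' a"
    by (simp add: monom_eval_superset[of ?S])
  finally show ?thesis .
qed

lemma mpoly_eval_superset:
  assumes "finite S" "Poly_Mapping.keys p \<subseteq> S"
  shows "mpoly_eval p a = (\<Sum>m\<in>S. Poly_Mapping.lookup p m * monom_eval m a)"
  unfolding mpoly_eval_def
  by (rule sum.mono_neutral_left) (use assms in \<open>auto simp: in_keys_iff\<close>)

lemma mpoly_eval_0 [simp]: "mpoly_eval 0 a = 0"
  by (simp add: mpoly_eval_def)

lemma mpoly_eval_single: "mpoly_eval (Poly_Mapping.single m c) a = c * monom_eval m a"
  by (simp add: mpoly_eval_superset[of "{m}"])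

lemma mpoly_eval_1 [simp]: "mpoly_eval 1 a = 1"
  using mpoly_eval_single[of 0 1 a] by simp

lemma mpoly_eval_mvar [simp]: "mpoly_eval (mvar i) a = a i"
  by (simp add: mvar_def mpoly_eval_single monom_eval_def)

lemma mpoly_eval_add: "mpoly_eval (p + q) a = mpoly_eval p a + mpoly_eval q a"
proof -
  let ?S = "Poly_Mapping.keys p \<union> Poly_Mapping.keys q"
  have "mpoly_eval (p + q) a = (\<Sum>m\<in>?S. Poly_Mapping.lookup (p + q) m * monom_eval m a)"
    by (rule mpoly_eval_superset) (use keys_add[of p q] in auto)
  also have "\<dots> = mpoly_eval p a + mpoly_eval q a"
    by (simp add: lookup_add distrib_right sum.distrib mpoly_eval_superset[of ?S])
  finally show ?thesis .
qed

lemma mpoly_eval_uminus: "mpoly_eval (- p) a = - mpoly_eval p a"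
  using mpoly_eval_add[of p "- p" a] by (simp add: eq_neg_iff_add_eq_0 add.commute)

lemma mpoly_eval_diff: "mpoly_eval (p - q) a = mpoly_eval p a - mpoly_eval q a"
  using mpoly_eval_add[of p "- q" a] by (simp add: mpoly_eval_uminus)

lemma mpoly_induct [case_names zero add]:
  assumes "P 0"
    and "\<And>p m c. P p \<Longrightarrow> P (p + Poly_Mapping.single m c)"
  shows "P (p :: 'a::field mpoly)"
proof (induction p rule: update_induct)
  case const
  show ?case by (fact assms(1))
next
  case (update p m c)
  have "Poly_Mapping.update m c p = p + Poly_Mapping.single m c"
    by (rule poly_mapping_eqI)
       (use update in \<open>auto simp: lookup_update lookup_add lookup_single in_keys_iff when_def\<close>)
  with update assms(2) show ?case by metis
qed

lemma mpoly_eval_mult: "mpoly_eval (p * q) a = mpoly_eval p a * mpoly_eval q a"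
proof (induction p rule: mpoly_induct)
  case zero
  show ?case by simp
next
  case (add p m c)
  have "mpoly_eval (Poly_Mapping.single m c * q) a
      = mpoly_eval (Poly_Mapping.single m c) a * mpoly_eval q a"
  proof (induction q rule: mpoly_induct)
    case zero
    show ?case by simp
  next
    case (add q m' c')
    then show ?case
      by (simp add: distrib_left mpoly_eval_add mult_single mpoly_eval_single monom_eval_add mult_ac)
  qed
  with add show ?case by (simp add: distrib_right mpoly_eval_add)
qed

lemma mpoly_eval_prod: "mpoly_eval (\<Prod>i\<in>I. p i) a = (\<Prod>i\<in>I. mpoly_eval (p i) a)"
  by (induction I rule: infinite_finite_induct) (simp_all add: mpoly_eval_mult)

lemma polys_mult: "p \<in> polys n \<Longrightarrow> q \<in> polys n \<Longrightarrow> p * q \<in> polys n"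
proof -
  assume p: "p \<in> polys n" and q: "q \<in> polys n"
  have "Poly_Mapping.keys m \<subseteq> {..<n}" if m: "m \<in> Poly_Mapping.keys (p * q)" for m
  proof -
    obtain m1 m2 where "m = m1 + m2" "m1 \<in> Poly_Mapping.keys p" "m2 \<in> Poly_Mapping.keys q"
      using m keys_mult[of p q] by auto
    with p q keys_add[of m1 m2] show ?thesis unfolding polys_def by blast
  qed
  then show ?thesis by (simp add: polys_def)
qed

definition affine_space :: "nat \<Rightarrow> (nat \<Rightarrow> 'a) set" where
  "affine_space n = {..<n} \<rightarrow>\<^sub>E UNIV"

definition zero_locus :: "nat \<Rightarrow> 'a::field mpoly set \<Rightarrow> (nat \<Rightarrow> 'a) set" where
  "zero_locus n S = {a \<in> affine_space n. \<forall>p\<in>S. mpoly_eval p a = 0}"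

definition zariski :: "nat \<Rightarrow> (nat \<Rightarrow> 'a::field) topology" where
  "zariski n = topology (\<lambda>U. U \<subseteq> affine_space n \<and>
    (\<exists>S \<subseteq> polys n. affine_space n - U = zero_locus n S))"

lemma istopology_zariski:
  "istopology (\<lambda>U :: (nat \<Rightarrow> 'a::field) set. U \<subseteq> affine_space n \<and>
    (\<exists>S \<subseteq> polys n. affine_space n - U = zero_locus n S))"
  unfolding istopology_def
proof (rule conjI; intro allI impI)
  fix U V :: "(nat \<Rightarrow> 'a) set"
  assume "U \<subseteq> affine_space n \<and> (\<exists>S \<subseteq> polys n. affine_space n - U = zero_locus n S)"
    and "V \<subseteq> affine_space n \<and> (\<exists>S \<subseteq> polys n. affine_space n - V = zero_locus n S)"
  then obtain S T where U: "U \<subseteq> affine_space n" "S \<subseteq> polys n" "affine_space n - U = zero_locus n S"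
    and V: "V \<subseteq> affine_space n" "T \<subseteq> polys n" "affine_space n - V = zero_locus n T" by blast
  let ?R = "{p * q | p q. p \<in> S \<and> q \<in> T}"
  have "?R \<subseteq> polys n" using U(2) V(2) by (auto intro: polys_mult)
  moreover have "zero_locus n ?R = zero_locus n S \<union> zero_locus n T"
    by (fastforce simp: zero_locus_def mpoly_eval_mult)
  moreover have "affine_space n - U \<inter> V = zero_locus n S \<union> zero_locus n T"
    using U(3) V(3) by blast
  ultimately show "U \<inter> V \<subseteq> affine_space n \<and>
      (\<exists>S \<subseteq> polys n. affine_space n - U \<inter> V = zero_locus n S)"
    using U(1) by (metis (no_types, lifting) inf.coboundedI1)
next
  fix K :: "(nat \<Rightarrow> 'a) set set"
  assume "\<forall>U\<in>K. U \<subseteq> affine_space n \<and> (\<exists>S \<subseteq> polys n. affine_space n - U = zero_locus n S)"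
  then obtain S where S: "\<And>U. U \<in> K \<Longrightarrow> U \<subseteq> affine_space n \<and> S U \<subseteq> polys n \<and>
      affine_space n - U = zero_locus n (S U)"
    by metis
  have "affine_space n - \<Union>K = zero_locus n (\<Union>U\<in>K. S U)"
  proof (rule set_eqI)
    fix a
    have "a \<notin> U \<longleftrightarrow> (\<forall>p\<in>S U. mpoly_eval p a = 0)" if "U \<in> K" "a \<in> affine_space n" for U
      using S[OF that(1)] that(2) unfolding zero_locus_def by blast
    then show "a \<in> affine_space n - \<Union>K \<longleftrightarrow> a \<in> zero_locus n (\<Union>U\<in>K. S U)"
      by (auto simp: zero_locus_def)
  qed
  moreover have "(\<Union>U\<in>K. S U) \<subseteq> polys n" "\<Union>K \<subseteq> affine_space n"
    using S by blast+
  ultimately show "\<Union>K \<subseteq> affine_space n \<and>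
      (\<exists>S \<subseteq> polys n. affine_space n - \<Union>K = zero_locus n S)"
    by blast
qed

lemma openin_zariski:
  "openin (zariski n) U \<longleftrightarrow>
    U \<subseteq> affine_space n \<and> (\<exists>S \<subseteq> polys n. affine_space n - U = zero_locus n S)"
  unfolding zariski_def topology_inverse'[OF istopology_zariski] ..

lemma topspace_zariski [simp]: "topspace (zariski n) = affine_space n"
proof -
  have "zero_locus n {1 :: 'a mpoly} = {}" by (simp add: zero_locus_def)
  moreover have "(1 :: 'a mpoly) \<in> polys n" by (simp add: polys_def)
  ultimately have "openin (zariski n) (affine_space n :: (nat \<Rightarrow> 'a) set)"
    unfolding openin_zariski by (intro conjI exI[of _ "{1}"]) auto
  then show ?thesis
    by (metis openin_subset openin_topspace openin_zariski subset_antisym)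
qed

lemma closedin_zariski: "closedin (zariski n) C \<longleftrightarrow> (\<exists>S \<subseteq> polys n. C = zero_locus n S)"
proof -
  have "zero_locus n S \<subseteq> affine_space n" for S :: "'a mpoly set"
    by (auto simp: zero_locus_def)
  then show ?thesis
    unfolding closedin_def openin_zariski topspace_zariski
    by (auto simp: double_diff)
qed

definition quotient_top :: "'b topology \<Rightarrow> ('b \<Rightarrow> 'c) \<Rightarrow> 'c topology" where
  "quotient_top X f = topology (\<lambda>U. U \<subseteq> f ` topspace X \<and> openin X {x \<in> topspace X. f x \<in> U})"

lemma istopology_quotient_top:
  "istopology (\<lambda>U. U \<subseteq> f ` topspace X \<and> openin X {x \<in> topspace X. f x \<in> U})"
  unfolding istopology_def
proof (rule conjI; intro allI impI)
  fix U V
  assume *: "U \<subseteq> f ` topspace X \<and> openin X {x \<in> topspace X. f x \<in> U}"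
    "V \<subseteq> f ` topspace X \<and> openin X {x \<in> topspace X. f x \<in> V}"
  have "{x \<in> topspace X. f x \<in> U \<inter> V}
      = {x \<in> topspace X. f x \<in> U} \<inter> {x \<in> topspace X. f x \<in> V}" by blast
  with * show "U \<inter> V \<subseteq> f ` topspace X \<and> openin X {x \<in> topspace X. f x \<in> U \<inter> V}"
    by (metis (no_types, lifting) inf.coboundedI1 openin_Int)
next
  fix K
  assume *: "\<forall>U\<in>K. U \<subseteq> f ` topspace X \<and> openin X {x \<in> topspace X. f x \<in> U}"
  have "{x \<in> topspace X. f x \<in> \<Union>K} = (\<Union>U\<in>K. {x \<in> topspace X. f x \<in> U})" by blast
  moreover have "openin X (\<Union>U\<in>K. {x \<in> topspace X. f x \<in> U})"
    using * by blast
  ultimately show "\<Union>K \<subseteq> f ` topspace X \<and> openin X {x \<in> topspace X. f x \<in> \<Union>K}"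
    using * by auto
qed

lemma openin_quotient_top:
  "openin (quotient_top X f) U \<longleftrightarrow> U \<subseteq> f ` topspace X \<and> openin X {x \<in> topspace X. f x \<in> U}"
  unfolding quotient_top_def topology_inverse'[OF istopology_quotient_top] ..

lemma topspace_quotient_top [simp]: "topspace (quotient_top X f) = f ` topspace X"
proof -
  have "{x \<in> topspace X. f x \<in> f ` topspace X} = topspace X" by blast
  then have "openin (quotient_top X f) (f ` topspace X)"
    unfolding openin_quotient_top by simp
  then show ?thesis
    by (metis openin_subset openin_topspace openin_quotient_top subset_antisym)
qed

lemma quotient_map_quotient_top: "quotient_map X (quotient_top X f) f"
  unfolding quotient_map_def openin_quotient_top by auto

definition disc_open :: "nat \<Rightarrow> (nat \<Rightarrow> 'a::field) set" where
  "disc_open n = {a \<in> affine_space n. mpoly_eval (disc_poly n) a \<noteq> 0}"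

lemma mpoly_eval_disc_poly:
  "mpoly_eval (disc_poly n) a =
    (\<Prod>(j, j') \<in> {(j, j'). j < n \<and> j' < n \<and> j \<noteq> j'}. a j - a j')"
  by (simp add: disc_poly_def mpoly_eval_prod case_prod_unfold mpoly_eval_diff)

lemma disc_open_eq: "disc_open n = {a \<in> affine_space n. inj_on a {..<n}}"
proof -
  have "finite {(j, j'). j < n \<and> j' < n \<and> j \<noteq> j'}"
    by (rule finite_subset[of _ "{..<n} \<times> {..<n}"]) auto
  then show ?thesis
    unfolding disc_open_def mpoly_eval_disc_poly by (auto simp: inj_on_def)
qed

definition point_set :: "nat \<Rightarrow> (nat \<Rightarrow> 'a) \<Rightarrow> 'a set" where
  "point_set n a = a ` {..<n}"

definition nsets_top :: "nat \<Rightarrow> 'a::field set topology" where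
  "nsets_top n = quotient_top (subtopology (zariski n) (disc_open n)) (point_set n)"

definition Sigma_top :: "nat \<Rightarrow> 'a::field set set topology" where
  "Sigma_top n = quotient_top (nsets_top n) poly_class"

lemma point_set_image: "point_set n ` disc_open n = (nsets n :: 'a::field set set)"
proof
  show "point_set n ` disc_open n \<subseteq> (nsets n :: 'a set set)"
    by (auto simp: disc_open_eq point_set_def nsets_def card_image)
  show "(nsets n :: 'a set set) \<subseteq> point_set n ` disc_open n"
  proof
    fix A :: "'a set" assume "A \<in> nsets n"
    then obtain h where h: "bij_betw h {..<n} A"
      unfolding nsets_def by (auto simp: lessThan_atLeast0 dest: ex_bij_betw_nat_finite)
    let ?a = "restrict h {..<n}"
    have "?a \<in> disc_open n" "point_set n ?a = A"
      using h by (auto simp: disc_open_eq affine_space_def point_set_def bij_betw_def inj_on_def)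
    then show "A \<in> point_set n ` disc_open n" by blast
  qed
qed

lemma topspace_nsets_top [simp]: "topspace (nsets_top n) = nsets n"
proof -
  have "affine_space n \<inter> disc_open n = (disc_open n :: (nat \<Rightarrow> 'a) set)"
    by (auto simp: disc_open_def)
  then show ?thesis by (simp add: nsets_top_def point_set_image)
qed

lemma topspace_Sigma_top [simp]: "topspace (Sigma_top n) = Sigma_n n"
  by (simp add: Sigma_top_def Sigma_n_def)

definition regular_nsets :: "nat \<Rightarrow> ('a::field set \<Rightarrow> 'a) set" where
  "regular_nsets n = {F \<in> nsets n \<rightarrow>\<^sub>E UNIV.
    \<exists>g r. g \<in> polys n \<and> symmetric_poly n g \<and>
      (\<forall>a \<in> disc_open n.
        F (point_set n a) = mpoly_eval g a / mpoly_eval (disc_poly n) a ^ r)}"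

definition invariant_regular :: "nat \<Rightarrow> ('a::field set \<Rightarrow> 'a) set" where
  "invariant_regular n = {F \<in> regular_nsets n.
    \<forall>P \<in> linear_polys. \<forall>A \<in> nsets n. F (poly P ` A) = F A}"

text \<open>The invariant regular functions, regarded as functions on the set of classes: those
  functions whose pullback along \<open>A \<mapsto> [A]\<close> is an invariant regular function.\<close>

definition Sigma_algebra :: "nat \<Rightarrow> ('a::field set set \<Rightarrow> 'a) set" where
  "Sigma_algebra n = {F \<in> Sigma_n n \<rightarrow>\<^sub>E UNIV.
    restrict (\<lambda>A. F (poly_class A)) (nsets n) \<in> invariant_regular n}"

end

theory Submission
  imports Defs
begin

text \<open>Everything is pulled back to tuples with distinct entries. There a subset of the orbit space
  becomes a set \<open>Z\<close> stable under \<open>a \<mapsto> c * (a \<circ> \<pi>) + c'\<close> for permutations \<open>\<pi>\<close> and \<open>c \<noteq> 0\<close>, and the subset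
  is closed iff \<open>Z\<close> is the trace of a Zariski closed set (\<open>closedin_Sigma_top\<close>). The zero set of an
  invariant regular function is closed because its pullback is cut out by the numerator, the
  discriminant being invertible.

  For the converse, a point \<open>a\<close> outside \<open>Z\<close> has to be separated from \<open>Z\<close> by an invariant regular function
  (\<open>separating_function\<close>). The affine group is not reductive, so the theorem on quotients by reductive
  groups does not apply; instead the three parts of the group are treated one after the other.

  \<^item> Translations. In characteristic zero, subtracting the mean from all entries is a polynomial map that is
    constant on translation orbits, and it preserves both \<open>Z\<close> and its complement. So some polynomial \<open>p\<close>
    vanishing on \<open>Z\<close> does not vanish at the centred \<open>a\<close>, and \<open>p\<close> composed with centring is
    translation invariant.
  \<^item> Scalings. On the ray through a centred point of \<open>Z\<close>, \<open>p\<close> is a polynomial in the scaling factor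
    with infinitely many zeros, hence each homogeneous component of \<open>p\<close> vanishes at that point
    (\<open>hom_part_eq_0\<close>). One of the components, \<open>h\<close>, is nonzero at the centred \<open>a\<close>.
  \<^item> Permutations. Let \<open>h\<close> be composed with centring. Some power sum with positive exponent of its
    values at the permuted tuples is nonzero at \<open>a\<close> (\<open>power_sum_nonzero\<close>), and all of these power sums vanish on \<open>Z\<close>.

  The resulting function is symmetric, translation invariant and homogeneous. So is the
  discriminant, which is nonzero at tuples with distinct entries; a quotient of suitable powers has degree zero
  and is therefore invariant (\<open>semi_invariant_quotient\<close>).

  That such a quotient descends to classes uses that two equivalent sets are images of
  each other under a linear polynomial (\<open>poly_equiv_imp_linear_image\<close>): equality of
  cardinalities forces the fibres of the reducing polynomial to be singletons, and in characteristic zero a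
  nonlinear polynomial over an algebraically closed field has at most one singleton fibre.\<close>

section \<open>Equivalent sets are linear images of each other\<close>

lemma poly_equiv_linear_image:
  fixes A :: "'a::field set"
  assumes "P \<in> linear_polys"
  shows "A \<equiv>\<^sub>p poly P ` A"
proof -
  obtain c c' where P: "P = [:c', c:]" and c: "c \<noteq> 0"
    using assms by (auto simp: linear_polys_def)
  have "A = poly P -` (poly P ` A)" using c by (auto simp: P)
  moreover have "poly P ` A = poly [:- c' / c, 1 / c:] -` A"
  proof (intro set_eqI iffI)
    fix y assume "y \<in> poly P ` A"
    then show "y \<in> poly [:- c' / c, 1 / c:] -` A" using c by (auto simp: P field_simps)
  next
    fix y assume "y \<in> poly [:- c' / c, 1 / c:] -` A"
    moreover have "y = poly P (poly [:- c' / c, 1 / c:] y)" using c by (simp add: P field_simps)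
    ultimately show "y \<in> poly P ` A" by blast
  qed
  ultimately show ?thesis unfolding poly_equiv_def poly_reducible_def by blast
qed

lemma unique_root_imp_power:
  fixes q :: "'a::alg_closed_field poly"
  assumes "q \<noteq> 0" and roots: "\<And>y. poly q y = 0 \<Longrightarrow> y = x"
  shows "q = smult (lead_coeff q) ([:- x, 1:] ^ degree q)"
proof -
  obtain M where M: "size M = degree q" "q = smult (lead_coeff q) (\<Prod>y\<in>#M. [:- y, 1:])"
    using alg_closed_imp_factorization[OF assms(1)] by blast
  have "y = x" if y: "y \<in># M" for y
  proof (rule roots)
    obtain M' where "M = add_mset y M'" using y by (metis insert_DiffM)
    then have "poly (\<Prod>y\<in>#M. [:- y, 1:]) y = 0" by simp
    then show "poly q y = 0" by (subst M(2)) simp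
  qed
  then have "M = replicate_mset (degree q) x"
    using set_mset_subset_singletonD[of M x] M(1) by auto
  then have "(\<Prod>y\<in>#M. [:- y, 1:]) = [:- x, 1:] ^ degree q" by simp
  with M(2) show ?thesis by simp
qed

lemma degree_diff_const:
  fixes P :: "'a::field poly"
  assumes "degree P > 0"
  shows "degree (P - [:b:]) = degree P"
  unfolding diff_conv_add_uminus by (rule degree_add_eq_left) (use assms in simp)

text \<open>If the fibre through \<open>z\<close> is a singleton, \<open>P\<close> is a constant plus a multiple of \<open>(X - z) ^ degree P\<close>, so
  the only possible zero of its derivative is \<open>z\<close>, and it is a zero as soon as the degree exceeds \<open>1\<close>.
  Two such points are incompatible.\<close>

lemma degree_eq_1_if_fibres_singleton:
  fixes P :: "'a::{alg_closed_field, field_char_0} poly"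
  assumes deg: "degree P > 0" and "x \<noteq> x'"
    and fib: "\<And>y. poly P y = poly P x \<Longrightarrow> y = x" "\<And>y. poly P y = poly P x' \<Longrightarrow> y = x'"
  shows "degree P = 1"
proof (rule ccontr)
  assume "degree P \<noteq> 1"
  with deg have d: "degree P \<ge> 2" by simp
  have *: "poly (pderiv P) y = lead_coeff P * of_nat (degree P) * (y - z) ^ (degree P - 1)"
    if fib: "\<And>y. poly P y = poly P z \<Longrightarrow> y = z" for y z
  proof -
    define q where "q = P - [:poly P z:]"
    have q: "degree q = degree P" "lead_coeff q = lead_coeff P" "pderiv q = pderiv P"
      using deg by (simp_all add: q_def degree_diff_const pderiv_diff pderiv_pCons coeff_pCons
          split: nat.splits)
    have "q = smult (lead_coeff q) ([:- z, 1:] ^ degree q)"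
      by (rule unique_root_imp_power) (use deg fib q(1) in \<open>auto simp: q_def\<close>)
    then have "pderiv P = pderiv (smult (lead_coeff P) ([:- z, 1:] ^ degree P))"
      using q by simp
    moreover obtain e where e: "degree P = Suc e" using deg gr0_implies_Suc by blast
    ultimately show ?thesis
      unfolding e pderiv_smult pderiv_power_Suc
      by (simp add: pderiv_pCons mult.assoc del: of_nat_Suc power_Suc)
  qed
  have "poly (pderiv P) x' = 0" using *[OF fib(2), of x'] d by simp
  moreover have "poly (pderiv P) x' \<noteq> 0" using *[OF fib(1), of x'] d \<open>x \<noteq> x'\<close> by auto
  ultimately show False by simp
qed

text \<open>Since \<open>{0}\<close> is its own preimage under \<open>X ^ d\<close> for every \<open>d \<ge> 1\<close>, the reducing polynomial
  itself need not be linear when \<open>n = 1\<close>; there a translation takes its place.\<close>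

lemma poly_equiv_imp_linear_image:
  fixes A B :: "'a::{alg_closed_field, field_char_0} set"
  assumes "A \<in> nsets n" "B \<in> nsets n" "n \<ge> 1" "A \<equiv>\<^sub>p B"
  obtains P where "P \<in> linear_polys" "B = poly P ` A"
proof -
  from assms have fin: "finite A" "finite B" and card: "card A = n" "card B = n"
    by (auto simp: nsets_def)
  obtain P where P: "A = poly P -` B"
    using assms by (auto simp: poly_equiv_def poly_reducible_def)
  have deg: "degree P > 0"
  proof (rule ccontr)
    assume "\<not> degree P > 0"
    then obtain c where "P = [:c:]" by (auto elim: degree_eq_zeroE)
    then have "A = {} \<or> A = UNIV" using P by auto
    then show False using fin card \<open>n \<ge> 1\<close> infinite_UNIV_char_0 by auto
  qed
  have im: "poly P ` A = B"
  proof
    show "poly P ` A \<subseteq> B" using P by auto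
    show "B \<subseteq> poly P ` A"
    proof
      fix b assume b: "b \<in> B"
      have "degree (P - [:b:]) > 0" using deg by (simp add: degree_diff_const)
      then obtain x where "poly (P - [:b:]) x = 0" using alg_closed_imp_poly_has_root by blast
      then show "b \<in> poly P ` A" using P b by force
    qed
  qed
  have inj: "inj_on (poly P) A"
    by (rule eq_card_imp_inj_on) (use fin card im in auto)
  show thesis
  proof (cases "n = 1")
    case True
    then obtain x y where "A = {x}" "B = {y}" using card card_1_singletonE by metis
    then show thesis
      by (intro that[of "[:y - x, 1:]"]) (auto simp: linear_polys_def)
  next
    case False
    then have "\<not> card A \<le> Suc 0" using card \<open>n \<ge> 1\<close> by simp
    then obtain x x' where x: "x \<in> A" "x' \<in> A" "x \<noteq> x'"
      using fin(1) by (auto simp: card_le_Suc0_iff_eq)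
    have "y = z" if "z \<in> A" "poly P y = poly P z" for y z
      using that P inj by (metis inj_onD vimageE vimageI2)
    with x have "degree P = 1"
      by (intro degree_eq_1_if_fibres_singleton[OF deg x(3)]) blast+
    then show thesis using im by (intro that[of P]) (auto simp: linear_polys_eq)
  qed
qed

text \<open>The same result for enumerations of the sets, where matching the enumerations costs a permutation.\<close>

lemma equivalent_points:
  fixes a b :: "nat \<Rightarrow> 'a::{alg_closed_field, field_char_0}"
  assumes "n \<ge> 1" "a \<in> disc_open n" "b \<in> disc_open n"
    and "poly_class (point_set n a) = poly_class (point_set n b)"
  obtains c \<pi> c' where "c \<noteq> 0" "\<pi> permutes {..<n}" "\<And>i. i < n \<Longrightarrow> b i = c * a (\<pi> i) + c'"
proof -
  have "point_set n a \<in> nsets n" "point_set n b \<in> nsets n"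
    using assms point_set_image by blast+
  then obtain P where P: "P \<in> linear_polys" "point_set n b = poly P ` point_set n a"
    using assms(1,4) poly_equiv_imp_linear_image unfolding poly_class_eq_iff by metis
  then obtain c c' where c: "P = [:c', c:]" "c \<noteq> 0" by (auto simp: linear_polys_def)
  define l where "l = (\<lambda>x. c * x + c')"
  have l: "inj l" using c by (auto simp: l_def inj_def)
  have "b ` {..<n} = (l \<circ> a) ` {..<n}"
    using P(2) c(1) by (auto simp: point_set_def l_def image_comp o_def algebra_simps)
  moreover have inj: "inj_on b {..<n}" "inj_on (l \<circ> a) {..<n}"
    using assms l by (auto simp: disc_open_eq intro!: comp_inj_on intro: inj_on_subset)
  ultimately have bij: "bij_betw b {..<n} (b ` {..<n})" "bij_betw (l \<circ> a) {..<n} (b ` {..<n})"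
    by (auto simp: bij_betw_def)
  define \<sigma> where "\<sigma> = inv_into {..<n} (l \<circ> a) \<circ> b"
  have \<sigma>: "bij_betw \<sigma> {..<n} {..<n}"
    unfolding \<sigma>_def by (rule bij_betw_trans[OF bij(1) bij_betw_inv_into[OF bij(2)]])
  define \<pi> where "\<pi> = (\<lambda>i. if i < n then \<sigma> i else i)"
  have "bij_betw \<pi> {..<n} {..<n} = bij_betw \<sigma> {..<n} {..<n}"
    by (rule bij_betw_cong) (simp add: \<pi>_def)
  with \<sigma> have "\<pi> permutes {..<n}"
    by (intro bij_imp_permutes) (auto simp: \<pi>_def)
  moreover have "b i = c * a (\<pi> i) + c'" if "i < n" for i
  proof -
    have "b i \<in> (l \<circ> a) ` {..<n}" using that bij by (auto simp: bij_betw_def)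
    then have "(l \<circ> a) (\<sigma> i) = b i" unfolding \<sigma>_def o_def[of _ b] by (rule f_inv_into_f)
    then show ?thesis using that by (simp add: \<pi>_def l_def)
  qed
  ultimately show thesis using that c(2) by blast
qed

section \<open>Polynomial functions and symmetric polynomials\<close>

text \<open>Invariance is a property of functions, and formal manipulation of coefficients is best avoided; so
  the constructions below are carried out on polynomial functions, given on all of
  \<open>nat \<Rightarrow> 'a\<close> to make composition painless.\<close>

definition polyfun :: "nat \<Rightarrow> ((nat \<Rightarrow> 'a::field) \<Rightarrow> 'a) \<Rightarrow> bool" where
  "polyfun n f \<longleftrightarrow> (\<exists>p\<in>polys n. \<forall>a. f a = mpoly_eval p a)"

lemma polys_single_0: "Poly_Mapping.single 0 c \<in> polys n"
  by (auto simp: polys_def)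

lemma polys_add: "p \<in> polys n \<Longrightarrow> q \<in> polys n \<Longrightarrow> p + q \<in> polys n"
  using keys_add[of p q] unfolding polys_def by blast

lemma polys_sum: "(\<And>i. i \<in> I \<Longrightarrow> p i \<in> polys n) \<Longrightarrow> (\<Sum>i\<in>I. p i) \<in> polys n"
  by (induction I rule: infinite_finite_induct) (use polys_single_0[of 0 n] in \<open>auto intro: polys_add\<close>)

lemma mpoly_eval_sum: "mpoly_eval (\<Sum>i\<in>I. p i) a = (\<Sum>i\<in>I. mpoly_eval (p i) a)"
  by (induction I rule: infinite_finite_induct) (simp_all add: mpoly_eval_add)

lemma polyfun_const: "polyfun n (\<lambda>_. c)"
  unfolding polyfun_def
  by (intro bexI[of _ "Poly_Mapping.single 0 c"]) (auto simp: mpoly_eval_single polys_single_0)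

lemma polyfun_var: "i < n \<Longrightarrow> polyfun n (\<lambda>a. a i)"
  unfolding polyfun_def
  by (intro bexI[of _ "mvar i"] allI mpoly_eval_mvar[symmetric])
     (simp add: polys_def mvar_def)

lemma polyfun_add: "polyfun n f \<Longrightarrow> polyfun n g \<Longrightarrow> polyfun n (\<lambda>a. f a + g a)"
  unfolding polyfun_def by (metis mpoly_eval_add polys_add)

lemma polyfun_mult: "polyfun n f \<Longrightarrow> polyfun n g \<Longrightarrow> polyfun n (\<lambda>a. f a * g a)"
  unfolding polyfun_def by (metis mpoly_eval_mult polys_mult)

lemma polyfun_sum: "(\<And>i. i \<in> I \<Longrightarrow> polyfun n (f i)) \<Longrightarrow> polyfun n (\<lambda>a. \<Sum>i\<in>I. f i a)"
  by (induction I rule: infinite_finite_induct) (auto intro: polyfun_add polyfun_const)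

lemma polyfun_prod: "(\<And>i. i \<in> I \<Longrightarrow> polyfun n (f i)) \<Longrightarrow> polyfun n (\<lambda>a. \<Prod>i\<in>I. f i a)"
  by (induction I rule: infinite_finite_induct) (auto intro: polyfun_mult polyfun_const)

lemma polyfun_power: "polyfun n f \<Longrightarrow> polyfun n (\<lambda>a. f a ^ j)"
  by (induction j) (auto intro: polyfun_mult polyfun_const)

lemma polyfun_monom_eval_comp:
  assumes "Poly_Mapping.keys m \<subseteq> {..<n}" "\<And>i. i < n \<Longrightarrow> polyfun n (h i)"
  shows "polyfun n (\<lambda>a. monom_eval m (\<lambda>i. h i a))"
  unfolding monom_eval_def using assms by (intro polyfun_prod polyfun_power) auto

lemma monom_eval_cong:
  "(\<And>i. i \<in> Poly_Mapping.keys m \<Longrightarrow> a i = b i) \<Longrightarrow> monom_eval m a = monom_eval m b"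
  by (simp add: monom_eval_def)

lemma mpoly_eval_cong:
  assumes "p \<in> polys n" "\<And>i. i < n \<Longrightarrow> a i = b i"
  shows "mpoly_eval p a = mpoly_eval p b"
  unfolding mpoly_eval_def
  using assms by (intro sum.cong refl arg_cong2[where f = "(*)"] monom_eval_cong) (auto simp: polys_def)

lemma polyfun_cong:
  assumes "polyfun n f" "\<And>i. i < n \<Longrightarrow> a i = b i"
  shows "f a = f b"
  using assms mpoly_eval_cong unfolding polyfun_def by metis

lemma polyfun_permute:
  assumes "polyfun n f" "\<pi> permutes {..<n}"
  shows "polyfun n (\<lambda>a. f (a \<circ> \<pi>))"
proof -
  obtain p where p: "p \<in> polys n" "\<And>a. f a = mpoly_eval p a"
    using assms(1) by (auto simp: polyfun_def)
  have "polyfun n (\<lambda>a. monom_eval m (\<lambda>i. a (\<pi> i)))" if "m \<in> Poly_Mapping.keys p" for m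
    by (rule polyfun_monom_eval_comp)
       (use that p permutes_in_image[OF assms(2)] in \<open>auto simp: polys_def intro!: polyfun_var\<close>)
  then show ?thesis
    unfolding p(2) mpoly_eval_def o_def
    by (intro polyfun_sum polyfun_mult polyfun_const)
qed

definition permute_poly :: "(nat \<Rightarrow> nat) \<Rightarrow> 'a::field mpoly \<Rightarrow> 'a mpoly" where
  "permute_poly \<pi> p = Poly_Mapping.map_key (Poly_Mapping.map_key \<pi>) p"

lemma lookup_map_key:
  "inj \<pi> \<Longrightarrow> Poly_Mapping.lookup (Poly_Mapping.map_key \<pi> m) i = Poly_Mapping.lookup m (\<pi> i)"
  by (simp add: map_key.rep_eq)

lemma bij_map_key:
  fixes \<pi> :: "nat \<Rightarrow> nat"
  assumes "bij \<pi>"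
  shows "bij (Poly_Mapping.map_key \<pi> :: (nat \<Rightarrow>\<^sub>0 nat) \<Rightarrow> _)"
proof (rule o_bij)
  have inj: "inj \<pi>" "inj (inv \<pi>)" using assms by (simp_all add: bij_is_inj bij_imp_bij_inv)
  show "Poly_Mapping.map_key (inv \<pi>) \<circ> Poly_Mapping.map_key \<pi> = (id :: (nat \<Rightarrow>\<^sub>0 nat) \<Rightarrow> _)"
    "Poly_Mapping.map_key \<pi> \<circ> Poly_Mapping.map_key (inv \<pi>) = (id :: (nat \<Rightarrow>\<^sub>0 nat) \<Rightarrow> _)"
    using assms inj
    by (auto intro!: ext poly_mapping_eqI simp: lookup_map_key bij_is_surj surj_f_inv_f)
qed

lemma lookup_permute_poly:
  "bij \<pi> \<Longrightarrow> Poly_Mapping.lookup (permute_poly \<pi> p) m =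
    Poly_Mapping.lookup p (Poly_Mapping.map_key \<pi> m)"
  by (simp add: permute_poly_def map_key.rep_eq bij_is_inj[OF bij_map_key])

lemma keys_permute_poly:
  "bij \<pi> \<Longrightarrow> Poly_Mapping.keys (permute_poly \<pi> p) =
    Poly_Mapping.map_key \<pi> -` Poly_Mapping.keys p"
  by (auto simp: in_keys_iff lookup_permute_poly)

lemma permute_poly_in_polys:
  assumes "p \<in> polys n" "\<pi> permutes {..<n}"
  shows "permute_poly \<pi> p \<in> polys n"
  unfolding polys_def
proof (intro CollectI ballI subsetI)
  fix m i
  assume m: "m \<in> Poly_Mapping.keys (permute_poly \<pi> p)" and i: "i \<in> Poly_Mapping.keys m"
  have b: "bij \<pi>" using assms(2) by (rule permutes_bij)
  have "inv \<pi> i \<in> Poly_Mapping.keys (Poly_Mapping.map_key \<pi> m)"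
    using i b by (simp add: keys_map_key bij_is_inj bij_is_surj surj_f_inv_f)
  then have "inv \<pi> i < n" using m assms(1) b by (auto simp: keys_permute_poly polys_def)
  then show "i \<in> {..<n}"
    using permutes_in_image[OF permutes_inv[OF assms(2)]] by blast
qed

lemma monom_eval_map_key:
  assumes "bij \<pi>"
  shows "monom_eval (Poly_Mapping.map_key \<pi> m) (a \<circ> \<pi>) = monom_eval m a"
proof -
  have "bij_betw \<pi> (\<pi> -` Poly_Mapping.keys m) (Poly_Mapping.keys m)"
    using assms by (auto simp: bij_betw_def surj_image_vimage_eq bij_is_surj
        intro: inj_on_subset bij_is_inj)
  from prod.reindex_bij_betw[OF this, of "\<lambda>i. a i ^ Poly_Mapping.lookup m i"] show ?thesis
    using assms by (simp add: monom_eval_def keys_map_key lookup_map_key bij_is_inj)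
qed

lemma mpoly_eval_permute_poly:
  assumes "bij \<pi>"
  shows "mpoly_eval (permute_poly \<pi> p) a = mpoly_eval p (a \<circ> \<pi>)"
proof -
  have "bij_betw (Poly_Mapping.map_key \<pi>) (Poly_Mapping.keys (permute_poly \<pi> p)) (Poly_Mapping.keys p)"
    using bij_map_key[OF assms] assms
    by (auto simp: keys_permute_poly bij_betw_def inj_on_def surj_image_vimage_eq dest: injD)
  from sum.reindex_bij_betw[OF this,
      of "\<lambda>m. Poly_Mapping.lookup p m * monom_eval m (a \<circ> \<pi>)"]
  show ?thesis
    unfolding mpoly_eval_def
    by (simp add: lookup_permute_poly[OF assms] monom_eval_map_key[OF assms])
qed

text \<open>Averaging any representing polynomial over the symmetric group makes its coefficients symmetric
  and leaves the function unchanged.\<close>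

lemma symmetric_poly_representative:
  fixes f :: "(nat \<Rightarrow> 'a::field_char_0) \<Rightarrow> 'a"
  assumes "polyfun n f" and sym: "\<And>\<pi> a. \<pi> permutes {..<n} \<Longrightarrow> f (a \<circ> \<pi>) = f a"
  shows "\<exists>g\<in>polys n. symmetric_poly n g \<and> (\<forall>a. mpoly_eval g a = f a)"
proof -
  obtain p where p: "p \<in> polys n" "\<And>a. f a = mpoly_eval p a"
    using assms(1) by (auto simp: polyfun_def)
  define S where "S = {\<pi>. \<pi> permutes {..<n}}"
  have S: "finite S" "S \<noteq> {}"
    unfolding S_def by (auto simp: finite_permutations intro!: exI[of _ id] permutes_id)
  define c :: 'a where "c = 1 / of_nat (card S)"
  define p' where "p' = Poly_Mapping.single 0 c * p"
  define g where "g = (\<Sum>\<pi>\<in>S. permute_poly \<pi> p')"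
  have p': "p' \<in> polys n" unfolding p'_def by (intro polys_mult polys_single_0 p(1))
  show ?thesis
  proof (intro bexI conjI allI)
    show "g \<in> polys n" unfolding g_def S_def
      by (intro polys_sum permute_poly_in_polys p') auto
    show "symmetric_poly n g" unfolding symmetric_poly_def
    proof (intro allI impI)
      fix \<sigma> m assume \<sigma>: "\<sigma> permutes {..<n}"
      have "Poly_Mapping.lookup g (Poly_Mapping.map_key \<sigma> m)
          = (\<Sum>\<pi>\<in>S. Poly_Mapping.lookup p' (Poly_Mapping.map_key (\<sigma> \<circ> \<pi>) m))"
        unfolding g_def lookup_sum
        by (intro sum.cong refl)
           (use \<sigma> in \<open>auto simp: S_def lookup_permute_poly permutes_bij map_key_compose permutes_inj\<close>)
      also have "\<dots> = (\<Sum>\<pi>\<in>S. Poly_Mapping.lookup p' (Poly_Mapping.map_key \<pi> m))"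
        unfolding S_def by (rule setum_permutations_compose_left[OF \<sigma>, symmetric])
      also have "\<dots> = Poly_Mapping.lookup g m"
        unfolding g_def lookup_sum
        by (intro sum.cong refl) (auto simp: S_def lookup_permute_poly permutes_bij)
      finally show "Poly_Mapping.lookup g (Poly_Mapping.map_key \<sigma> m) = Poly_Mapping.lookup g m" .
    qed
    fix a
    have "mpoly_eval g a = (\<Sum>\<pi>\<in>S. c * f a)"
      unfolding g_def mpoly_eval_sum
      by (intro sum.cong refl)
         (auto simp: S_def mpoly_eval_permute_poly permutes_bij p'_def mpoly_eval_mult
           mpoly_eval_single sym simp flip: p(2))
    then show "mpoly_eval g a = f a" using S by (simp add: c_def)
  qed
qed

section \<open>Behaviour of the discriminant under the group actions\<close>

lemma disc_eval_permute:
  assumes "\<pi> permutes {..<n}"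
  shows "mpoly_eval (disc_poly n) (a \<circ> \<pi>) = mpoly_eval (disc_poly n) (a :: nat \<Rightarrow> 'a::field)"
proof -
  let ?I = "{(j, j'). j < n \<and> j' < n \<and> j \<noteq> j'}"
  have "bij_betw (map_prod \<pi> \<pi>) ?I ?I"
  proof (rule bij_betwI[of _ _ _ "map_prod (inv \<pi>) (inv \<pi>)"])
    show "map_prod \<pi> \<pi> \<in> ?I \<rightarrow> ?I"
      using permutes_in_image[OF assms] permutes_inj[OF assms] by (auto dest: injD)
    show "map_prod (inv \<pi>) (inv \<pi>) \<in> ?I \<rightarrow> ?I"
      using permutes_in_image[OF permutes_inv[OF assms]] permutes_inj[OF permutes_inv[OF assms]]
      by (auto dest: injD)
  qed (use permutes_inverses[OF assms] in auto)
  from prod.reindex_bij_betw[OF this, of "\<lambda>(j, j'). a j - a j'"] show ?thesis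
    by (simp add: mpoly_eval_disc_poly case_prod_unfold)
qed

lemma disc_eval_affine:
  "mpoly_eval (disc_poly n) (\<lambda>i. c * a i + c')
    = c ^ (n * (n - 1)) * mpoly_eval (disc_poly n) (a :: nat \<Rightarrow> 'a::field)"
proof -
  let ?I = "{(j, j'). j < n \<and> j' < n \<and> j \<noteq> j'}"
  have "?I = Sigma {..<n} (\<lambda>j. {..<n} - {j})" by auto
  then have "card ?I = n * (n - 1)" by simp
  then show ?thesis
    unfolding mpoly_eval_disc_poly case_prod_unfold
    by (simp add: prod.distrib flip: right_diff_distrib)
qed


lemma disc_open_affine_permute:
  assumes "a \<in> disc_open n" "c \<noteq> 0" "\<pi> permutes {..<n}"
  shows "restrict (\<lambda>i. c * a (\<pi> i) + c') {..<n} \<in> disc_open n"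
  using assms permutes_in_image[OF assms(3)] permutes_inj[OF assms(3)]
  by (auto simp: disc_open_eq affine_space_def inj_on_def dest: injD)

lemma poly_class_affine_permute:
  fixes a :: "nat \<Rightarrow> 'a::field"
  assumes "c \<noteq> 0" "\<pi> permutes {..<n}"
  shows "poly_class (point_set n (restrict (\<lambda>i. c * a (\<pi> i) + c') {..<n})) = poly_class (point_set n a)"
proof -
  have "point_set n (restrict (\<lambda>i. c * a (\<pi> i) + c') {..<n}) = (\<lambda>j. c * a j + c') ` \<pi> ` {..<n}"
    by (auto simp: point_set_def image_image)
  also have "\<dots> = poly [:c', c:] ` point_set n a"
    by (auto simp: permutes_image[OF assms(2)] point_set_def image_image algebra_simps)
  finally show ?thesis
    using poly_equiv_linear_image[of "[:c', c:]" "point_set n a"] assms(1)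
    unfolding poly_class_eq_iff linear_polys_def
    by (metis (mono_tags, lifting) CollectI equivp_poly_equiv equivp_symp)
qed

section \<open>Nonvanishing power sums and homogeneous components\<close>

text \<open>If all power sums vanished, so would the sum of \<open>Q (x i)\<close> for every polynomial \<open>Q\<close> without constant
  term. Choosing \<open>Q\<close> to vanish at all values except \<open>x i0\<close>, this sum is a nonzero
  multiple of \<open>Q (x i0)\<close>.\<close>

lemma power_sum_nonzero:
  fixes x :: "'i \<Rightarrow> 'a::field_char_0"
  assumes "finite I" "i0 \<in> I" "x i0 \<noteq> 0"
  obtains j where "j \<ge> 1" "(\<Sum>i\<in>I. x i ^ j) \<noteq> 0"
proof -
  define Q where "Q = [:0, 1:] * (\<Prod>v\<in>x ` I - {x i0}. [:- v, 1:])"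
  have Q0: "coeff Q 0 = 0" by (simp add: Q_def)
  have Q1: "poly Q (x i0) \<noteq> 0"
    using assms by (auto simp: Q_def poly_prod)
  have Q2: "poly Q (x i) = (if x i = x i0 then poly Q (x i0) else 0)" if "i \<in> I" for i
    using assms(1) that by (auto simp: Q_def poly_prod)
  have "(\<Sum>i\<in>I. poly Q (x i)) = of_nat (card {i\<in>I. x i = x i0}) * poly Q (x i0)"
    using assms(1) by (simp add: Q2 sum.If_cases Int_def)
  moreover have "card {i\<in>I. x i = x i0} \<noteq> 0" using assms by auto
  ultimately have "(\<Sum>i\<in>I. poly Q (x i)) \<noteq> 0" using Q1 by simp
  also have "(\<Sum>i\<in>I. poly Q (x i)) = (\<Sum>j\<le>degree Q. coeff Q j * (\<Sum>i\<in>I. x i ^ j))"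
    unfolding poly_altdef sum_distrib_left by (rule sum.swap)
  finally obtain j where "coeff Q j * (\<Sum>i\<in>I. x i ^ j) \<noteq> 0"
    by (meson sum.not_neutral_contains_not_neutral)
  moreover from this have "j \<noteq> 0" using Q0 by (intro notI) simp
  ultimately show thesis using that[of j] by simp
qed

definition total_degree :: "(nat \<Rightarrow>\<^sub>0 nat) \<Rightarrow> nat" where
  "total_degree m = (\<Sum>i\<in>Poly_Mapping.keys m. Poly_Mapping.lookup m i)"

lemma monom_eval_scale: "monom_eval m (\<lambda>i. c * a i) = c ^ total_degree m * monom_eval m a"
  by (simp add: monom_eval_def total_degree_def power_mult_distrib prod.distrib power_sum)

definition hom_part :: "nat \<Rightarrow> 'a::field mpoly \<Rightarrow> (nat \<Rightarrow> 'a) \<Rightarrow> 'a" where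
  "hom_part d p a = (\<Sum>m\<in>{m\<in>Poly_Mapping.keys p. total_degree m = d}.
    Poly_Mapping.lookup p m * monom_eval m a)"

lemma hom_part_scale: "hom_part d p (\<lambda>i. c * a i) = c ^ d * hom_part d p a"
  by (simp add: hom_part_def monom_eval_scale sum_distrib_left mult_ac)

text \<open>Along a line through the origin a polynomial becomes univariate, with the values of its
  homogeneous components as coefficients.\<close>

lemma mpoly_eval_scale:
  "mpoly_eval p (\<lambda>i. c * a i) = poly (\<Sum>d\<in>total_degree ` Poly_Mapping.keys p. monom (hom_part d p a) d) c"
proof -
  have "mpoly_eval p b = (\<Sum>d\<in>total_degree ` Poly_Mapping.keys p. hom_part d p b)" for b
    unfolding mpoly_eval_def hom_part_def by (rule sum.image_gen) simp
  then show ?thesis by (simp add: poly_sum poly_monom hom_part_scale mult.commute)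
qed

lemma hom_part_eq_0:
  fixes a :: "nat \<Rightarrow> 'a::field_char_0"
  assumes "\<And>c. c \<noteq> 0 \<Longrightarrow> mpoly_eval p (\<lambda>i. c * a i) = 0"
  shows "hom_part d p a = 0"
proof (cases "d \<in> total_degree ` Poly_Mapping.keys p")
  case True
  let ?q = "\<Sum>d\<in>total_degree ` Poly_Mapping.keys p. monom (hom_part d p a) d"
  have "UNIV - {0} \<subseteq> {c. poly ?q c = 0}" using assms by (auto simp: mpoly_eval_scale)
  moreover have "infinite (UNIV - {0 :: 'a})" by (simp add: infinite_UNIV_char_0)
  ultimately have "?q = 0" using poly_roots_finite finite_subset by blast
  moreover have "coeff ?q d = hom_part d p a"
    using True by (simp add: coeff_sum)
  ultimately show ?thesis by simp
next
  case False
  then have "{m\<in>Poly_Mapping.keys p. total_degree m = d} = {}" by auto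
  then show ?thesis unfolding hom_part_def by (simp only: sum.empty)
qed

text \<open>Subtracting the mean chooses a representative of each translation orbit by a linear map
  that commutes with scalings.\<close>

definition center :: "nat \<Rightarrow> (nat \<Rightarrow> 'a::field) \<Rightarrow> nat \<Rightarrow> 'a" where
  "center n a i = a i - (\<Sum>j<n. a j) / of_nat n"

lemma center_affine:
  fixes a :: "nat \<Rightarrow> 'a::field_char_0"
  assumes "n \<ge> 1"
  shows "center n (\<lambda>i. c * a i + c') = (\<lambda>i. c * center n a i)"
  using assms
  by (auto simp: center_def sum.distrib add_divide_distrib right_diff_distrib
      simp flip: sum_distrib_left)

lemma polyfun_center: "i < n \<Longrightarrow> polyfun n (\<lambda>a. center n a i)"
proof -
  assume "i < n"
  then have "polyfun n (\<lambda>a. a i + (- 1 / of_nat n) * (\<Sum>j<n. a j))"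
    by (intro polyfun_add polyfun_mult polyfun_sum polyfun_const polyfun_var) auto
  then show ?thesis by (simp add: center_def)
qed

lemma polyfun_hom_part_center:
  assumes "p \<in> polys n"
  shows "polyfun n (\<lambda>a. hom_part d p (center n a))"
proof -
  have "polyfun n (\<lambda>a. monom_eval m (center n a))" if "m \<in> Poly_Mapping.keys p" for m
    using polyfun_monom_eval_comp[of m n "\<lambda>i a. center n a i"] that assms polyfun_center
    by (auto simp: polys_def)
  then show ?thesis unfolding hom_part_def
    by (intro polyfun_sum polyfun_mult polyfun_const) auto
qed

section \<open>Invariant functions separating points from closed sets\<close>

text \<open>Under an affine substitution with factor \<open>c\<close> the discriminant is multiplied by \<open>c ^ (n * (n - 1))\<close>, one
  factor for each ordered pair of distinct indices. The weight of \<open>f\<close> is chosen to cancel this against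
  the \<open>e\<close>-th power in the denominator.\<close>

lemma semi_invariant_quotient:
  fixes f :: "(nat \<Rightarrow> 'a::{alg_closed_field, field_char_0}) \<Rightarrow> 'a"
  assumes n: "n \<ge> 1" and f: "polyfun n f"
    and sym: "\<And>\<pi> a. \<pi> permutes {..<n} \<Longrightarrow> f (a \<circ> \<pi>) = f a"
    and semi: "\<And>a c c'. f (\<lambda>i. c * a i + c') = c ^ (n * (n - 1) * e) * f a"
  shows "\<exists>F\<in>Sigma_algebra n. \<forall>a\<in>disc_open n.
    F (poly_class (point_set n a)) = f a / mpoly_eval (disc_poly n) a ^ e"
proof -
  define v where "v a = f a / mpoly_eval (disc_poly n) a ^ e" for a
  have v_eq: "v a = v b"
    if ab: "a \<in> disc_open n" "b \<in> disc_open n"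
      "poly_class (point_set n a) = poly_class (point_set n b)" for a b
  proof -
    obtain c \<pi> c' where c: "c \<noteq> 0" and \<pi>: "\<pi> permutes {..<n}"
      and b: "\<And>i. i < n \<Longrightarrow> b i = c * a (\<pi> i) + c'"
      by (rule equivalent_points[OF n ab]) blast
    let ?D = "mpoly_eval (disc_poly n) :: (nat \<Rightarrow> 'a) \<Rightarrow> 'a"
    have "f b = c ^ (n * (n - 1) * e) * f a"
      using polyfun_cong[OF f, of b "\<lambda>i. c * (a \<circ> \<pi>) i + c'"] b semi[of c "a \<circ> \<pi>" c'] sym[OF \<pi>]
      by simp
    moreover have "?D b = ?D (\<lambda>i. c * (a \<circ> \<pi>) i + c')"
      unfolding mpoly_eval_disc_poly by (rule prod.cong) (auto simp: b)
    then have "?D b = c ^ (n * (n - 1)) * ?D a"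
      using disc_eval_affine[of n c "a \<circ> \<pi>" c'] disc_eval_permute[OF \<pi>, of a] by simp
    ultimately show ?thesis using c by (simp add: v_def power_mult_distrib power_mult)
  qed
  define F where "F = restrict (\<lambda>s. v (SOME a. a \<in> disc_open n \<and> poly_class (point_set n a) = s)) (Sigma_n n)"
  have F_eq: "F (poly_class (point_set n a)) = v a" if a: "a \<in> disc_open n" for a
  proof -
    have "poly_class (point_set n a) \<in> Sigma_n n"
      using a point_set_image by (auto simp: Sigma_n_def)
    moreover have "v (SOME b. b \<in> disc_open n \<and> poly_class (point_set n b) = poly_class (point_set n a)) = v a"
      by (rule someI2[of _ a]) (use a v_eq[OF _ a] in blast)+
    ultimately show ?thesis by (simp add: F_def)
  qed
  obtain g where g: "g \<in> polys n" "symmetric_poly n g" "\<And>a. mpoly_eval g a = f a"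
    using symmetric_poly_representative[OF f sym] by blast
  let ?F = "restrict (\<lambda>A. F (poly_class A)) (nsets n)"
  have "?F \<in> regular_nsets n" unfolding regular_nsets_def
  proof (intro CollectI conjI exI[of _ g] exI[of _ e] g ballI)
    fix a :: "nat \<Rightarrow> 'a" assume a: "a \<in> disc_open n"
    then have "point_set n a \<in> nsets n" using point_set_image by blast
    then show "?F (point_set n a) = mpoly_eval g a / mpoly_eval (disc_poly n) a ^ e"
      by (simp add: F_eq[OF a] g v_def)
  qed simp
  moreover have "?F (poly P ` A) = ?F A" if "P \<in> linear_polys" "A \<in> nsets n" for P A
  proof -
    have "inj (poly P)" using that(1) by (auto simp: linear_polys_def inj_def)
    then have "poly P ` A \<in> nsets n"
      using that(2) by (auto simp: nsets_def card_image inj_on_subset)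
    moreover have "poly_class A = poly_class (poly P ` A)"
      unfolding poly_class_eq_iff by (rule poly_equiv_linear_image[OF that(1)])
    ultimately show ?thesis using that(2) by simp
  qed
  ultimately have "?F \<in> invariant_regular n" unfolding invariant_regular_def by blast
  moreover have "F \<in> Sigma_n n \<rightarrow>\<^sub>E UNIV" by (simp add: F_def)
  ultimately have "F \<in> Sigma_algebra n" unfolding Sigma_algebra_def by blast
  then show ?thesis using F_eq v_def by auto
qed

text \<open>This is the core of the argument: centring, a homogeneous component, a power sum over the symmetric group
  and division by the discriminant remove one part of the group action each. The hypothesis on \<open>a\<close> concerns the
  centred tuple because a polynomial that is nonzero at \<open>a\<close> may well vanish at the centred
  tuple.\<close>

lemma separating_function:
  fixes Z :: "(nat \<Rightarrow> 'a::{alg_closed_field, field_char_0}) set"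
  assumes n: "n \<ge> 1" and S: "S \<subseteq> polys n" and Z: "Z = disc_open n \<inter> zero_locus n S"
    and inv: "\<And>b c c' \<pi>. b \<in> Z \<Longrightarrow> c \<noteq> 0 \<Longrightarrow> \<pi> permutes {..<n} \<Longrightarrow>
        restrict (\<lambda>i. c * b (\<pi> i) + c') {..<n} \<in> Z"
    and a: "a \<in> disc_open n" "restrict (center n a) {..<n} \<notin> Z"
  shows "\<exists>F\<in>Sigma_algebra n. F (poly_class (point_set n a)) \<noteq> 0 \<and>
    (\<forall>b\<in>Z. F (poly_class (point_set n b)) = 0)"
proof -
  have "restrict (center n a) {..<n} \<in> disc_open n"
    using disc_open_affine_permute[OF a(1), of 1 id "- ((\<Sum>j<n. a j) / of_nat n)"] permutes_id
    by (simp add: center_def[abs_def])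
  then obtain p where p: "p \<in> S" "mpoly_eval p (restrict (center n a) {..<n}) \<noteq> 0"
    using a(2) Z by (auto simp: zero_locus_def disc_open_eq)
  have pn: "p \<in> polys n" using p(1) S by blast
  have p_center: "mpoly_eval p (center n a) \<noteq> 0"
    using p(2) mpoly_eval_cong[OF pn, of "restrict (center n a) {..<n}" "center n a"] by simp
  define h where "h d b = hom_part d p (center n b)" for d b
  have h_poly: "polyfun n (h d)" for d
    unfolding h_def[abs_def] by (rule polyfun_hom_part_center[OF pn])
  have h_affine: "h d (\<lambda>i. c * b i + c') = c ^ d * h d b" for d c c' b
    by (simp add: h_def center_affine[OF n] hom_part_scale)
  \<comment> \<open>All nonzero multiples of a centred point of \<open>Z\<close> lie in \<open>Z\<close>, hence are zeros of \<open>p\<close>.\<close>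
  have h_Z: "h d b = 0" if b: "b \<in> Z" for d b
    unfolding h_def
  proof (rule hom_part_eq_0)
    fix c :: 'a assume c: "c \<noteq> 0"
    define c' where "c' = - c * ((\<Sum>j<n. b j) / of_nat n)"
    have "restrict (\<lambda>i. c * b (id i) + c') {..<n} \<in> Z"
      by (rule inv[OF b c permutes_id])
    then have "mpoly_eval p (restrict (\<lambda>i. c * b (id i) + c') {..<n}) = 0"
      using p(1) Z by (auto simp: zero_locus_def)
    moreover have "mpoly_eval p (\<lambda>i. c * center n b i)
        = mpoly_eval p (restrict (\<lambda>i. c * b (id i) + c') {..<n})"
      by (rule mpoly_eval_cong[OF pn]) (simp add: center_def c'_def algebra_simps)
    ultimately show "mpoly_eval p (\<lambda>i. c * center n b i) = 0" by simp
  qed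
  obtain d where d: "h d a \<noteq> 0"
    using p_center hom_part_eq_0 mpoly_eval_scale[of p 1 "center n a"]
    by (auto simp: h_def poly_sum poly_monom elim: sum.not_neutral_contains_not_neutral)
  define G where "G = {\<pi>. \<pi> permutes {..<n}}"
  have G: "finite G" "id \<in> G" by (auto simp: G_def finite_permutations permutes_id)
  obtain j where j: "j \<ge> 1" "(\<Sum>\<pi>\<in>G. h d (a \<circ> \<pi>) ^ j) \<noteq> 0"
    using power_sum_nonzero[OF G, of "\<lambda>\<pi>. h d (a \<circ> \<pi>)"] d by auto
  \<comment> \<open>The degree of the \<open>M\<close>-th power has to be a multiple of the degree of the discriminant. For \<open>n = 1\<close>
    the latter is \<open>0\<close>, but then all tuples centre to \<open>0\<close>, so \<open>h d\<close> is nonzero only if \<open>d = 0\<close>.\<close>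
  obtain M e where M: "M \<ge> 1" "M * (d * j) = n * (n - 1) * e"
  proof (cases "n = 1")
    case True
    have "h d a = h d (\<lambda>i. 0 * a i + a 0)"
      by (rule polyfun_cong[OF h_poly]) (use True in auto)
    then have "d = 0" using d h_affine[of d 0 a "a 0"] by (cases d) auto
    then show thesis using that[of 1 0] by simp
  next
    case False
    then show thesis using that[of "n * (n - 1)" "d * j"] n by simp
  qed
  define f where "f b = (\<Sum>\<pi>\<in>G. h d (b \<circ> \<pi>) ^ j) ^ M" for b
  have f_poly: "polyfun n f" unfolding f_def[abs_def]
    by (intro polyfun_power polyfun_sum polyfun_permute h_poly) (simp add: G_def)
  have f_sym: "f (b \<circ> \<sigma>) = f b" if \<sigma>: "\<sigma> permutes {..<n}" for \<sigma> b
    using setum_permutations_compose_left[OF \<sigma>, of "\<lambda>\<pi>. h d (b \<circ> \<pi>) ^ j"]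
    by (simp add: f_def G_def o_assoc)
  have f_affine: "f (\<lambda>i. c * b i + c') = c ^ (n * (n - 1) * e) * f b" for b c c'
  proof -
    have "h d ((\<lambda>i. c * b i + c') \<circ> \<pi>) = c ^ d * h d (b \<circ> \<pi>)" for \<pi>
      using h_affine[of d c "b \<circ> \<pi>" c'] by (simp add: o_def)
    then have "f (\<lambda>i. c * b i + c') = (c ^ (d * j) * (\<Sum>\<pi>\<in>G. h d (b \<circ> \<pi>) ^ j)) ^ M"
      unfolding f_def sum_distrib_left
      by (simp add: power_mult_distrib power_mult)
    also have "\<dots> = c ^ (M * (d * j)) * f b"
      by (simp add: f_def power_mult_distrib power_mult[symmetric] mult.commute)
    finally show ?thesis using M(2) by simp
  qed
  have f_Z: "f b = 0" if b: "b \<in> Z" for b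
  proof -
    have "h d (b \<circ> \<pi>) = 0" if "\<pi> \<in> G" for \<pi>
    proof -
      have "h d (restrict (\<lambda>i. 1 * b (\<pi> i) + 0) {..<n}) = 0"
        by (rule h_Z, rule inv[OF b]) (use that in \<open>auto simp: G_def\<close>)
      then show ?thesis
        using polyfun_cong[OF h_poly[of d], of "restrict (\<lambda>i. 1 * b (\<pi> i) + 0) {..<n}" "b \<circ> \<pi>"] by simp
    qed
    then show ?thesis using j(1) M(1) by (simp add: f_def power_0_left)
  qed
  obtain F where F: "F \<in> Sigma_algebra n"
    "\<And>b. b \<in> disc_open n \<Longrightarrow>
      F (poly_class (point_set n b)) = f b / mpoly_eval (disc_poly n) b ^ e"
    using semi_invariant_quotient[OF n f_poly f_sym f_affine] by blast
  show ?thesis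
  proof (intro bexI[OF _ F(1)] conjI ballI)
    show "F (poly_class (point_set n a)) \<noteq> 0"
      using F(2)[OF a(1)] a(1) j(2) by (simp add: f_def disc_open_def)
    show "F (poly_class (point_set n b)) = 0" if "b \<in> Z" for b
      using F(2)[of b] f_Z[OF that] that Z by simp
  qed
qed

section \<open>The topology of the orbit space\<close>

lemma Sigma_n_eq: "Sigma_n n = (\<lambda>a. poly_class (point_set n a)) ` (disc_open n :: (nat \<Rightarrow> 'a::field) set)"
  by (simp add: Sigma_n_def image_image flip: point_set_image)

lemma closedin_Sigma_top:
  fixes C :: "'a::field set set set"
  shows "closedin (Sigma_top n) C \<longleftrightarrow> C \<subseteq> Sigma_n n \<and>
    (\<exists>S\<subseteq>polys n. {a \<in> disc_open n. poly_class (point_set n a) \<in> C} = disc_open n \<inter> zero_locus n S)"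
proof -
  let ?X = "subtopology (zariski n) (disc_open n) :: (nat \<Rightarrow> 'a) topology"
  have top: "topspace ?X = disc_open n" by (auto simp: disc_open_def)
  have q: "quotient_map ?X (Sigma_top n) (poly_class \<circ> point_set n)"
    unfolding Sigma_top_def nsets_top_def
    by (rule quotient_map_compose[OF quotient_map_quotient_top quotient_map_quotient_top])
  have "closedin (Sigma_top n) C \<longleftrightarrow> C \<subseteq> Sigma_n n \<and>
      closedin ?X {a \<in> disc_open n. poly_class (point_set n a) \<in> C}"
    using q unfolding quotient_map_closedin top
    by (metis (no_types, lifting) closedin_subset comp_apply topspace_Sigma_top Collect_cong)
  then show ?thesis
    unfolding closedin_subtopology closedin_zariski Int_commute[of "disc_open n"] by blast
qed

theorem proposition12:
  fixes n :: nat
  assumes "n \<ge> 1"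
  shows "(\<forall>F \<in> (Sigma_algebra n :: ('a::{alg_closed_field, field_char_0} set set \<Rightarrow> 'a) set).
            closedin (Sigma_top n) {s \<in> Sigma_n n. F s = 0}) \<and>
         (\<forall>C :: 'a set set set. closedin (Sigma_top n) C \<longrightarrow>
            (\<exists>\<B> \<subseteq> Sigma_algebra n. C = {s \<in> Sigma_n n. \<forall>F \<in> \<B>. F s = 0}))"
proof (intro conjI ballI allI impI)
  fix F :: "'a set set \<Rightarrow> 'a" assume "F \<in> Sigma_algebra n"
  then obtain g r where g: "g \<in> polys n"
    and F: "\<And>a. a \<in> disc_open n \<Longrightarrow> restrict (\<lambda>A. F (poly_class A)) (nsets n) (point_set n a)
      = mpoly_eval g a / mpoly_eval (disc_poly n) a ^ r"
    unfolding Sigma_algebra_def invariant_regular_def regular_nsets_def by blast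
  have "F (poly_class (point_set n a)) = 0 \<longleftrightarrow> mpoly_eval g a = 0" if a: "a \<in> disc_open n" for a
  proof -
    have "point_set n a \<in> nsets n" using a point_set_image by blast
    then show ?thesis using F[OF a] a by (simp add: disc_open_def)
  qed
  then have "{a \<in> disc_open n. poly_class (point_set n a) \<in> {s \<in> Sigma_n n. F s = 0}}
      = disc_open n \<inter> zero_locus n {g}"
    by (auto simp: zero_locus_def Sigma_n_eq disc_open_def)
  then show "closedin (Sigma_top n) {s \<in> Sigma_n n. F s = 0}"
    unfolding closedin_Sigma_top using g by (intro conjI exI[of _ "{g}"]) auto
next
  fix C :: "'a set set set" assume "closedin (Sigma_top n) C"
  define Z where "Z = {a \<in> disc_open n. poly_class (point_set n a) \<in> C}"
  from \<open>closedin (Sigma_top n) C\<close> obtain S where C: "C \<subseteq> Sigma_n n"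
    and S: "S \<subseteq> polys n" "Z = disc_open n \<inter> zero_locus n S"
    unfolding closedin_Sigma_top Z_def by blast
  have inv: "restrict (\<lambda>i. c * b (\<pi> i) + c') {..<n} \<in> Z \<longleftrightarrow> b \<in> Z"
    if "b \<in> disc_open n" "c \<noteq> 0" "\<pi> permutes {..<n}" for b c c' \<pi>
    using that by (simp add: Z_def disc_open_affine_permute poly_class_affine_permute)
  define \<B> where "\<B> = {F \<in> Sigma_algebra n. \<forall>s\<in>C. F s = 0}"
  have "s \<in> C" if s: "s \<in> Sigma_n n" "\<forall>F\<in>\<B>. F s = 0" for s
  proof (rule ccontr)
    assume "s \<notin> C"
    from s(1) obtain a where a: "a \<in> disc_open n" "s = poly_class (point_set n a)"
      unfolding Sigma_n_eq by blast
    have "a \<notin> Z" using a(2) \<open>s \<notin> C\<close> by (simp add: Z_def)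
    then have "restrict (center n a) {..<n} \<notin> Z"
      using inv[OF a(1), of 1 id "- ((\<Sum>j<n. a j) / of_nat n)"] permutes_id
      by (simp add: center_def[abs_def])
    moreover have "restrict (\<lambda>i. c * b (\<pi> i) + c') {..<n} \<in> Z"
      if "b \<in> Z" "c \<noteq> 0" "\<pi> permutes {..<n}" for b c c' \<pi>
      using that inv[of b c \<pi> c'] S(2) by blast
    ultimately obtain F where F: "F \<in> Sigma_algebra n" "F (poly_class (point_set n a)) \<noteq> 0"
      "\<And>b. b \<in> Z \<Longrightarrow> F (poly_class (point_set n b)) = 0"
      using separating_function[OF assms S _ a(1)] by blast
    have "F t = 0" if "t \<in> C" for t
      using that C F(3) by (auto simp: Sigma_n_eq Z_def)
    then show False using F(1,2) s(2) a(2) by (auto simp: \<B>_def)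
  qed
  then have "C = {s \<in> Sigma_n n. \<forall>F\<in>\<B>. F s = 0}" using C by (auto simp: \<B>_def)
  moreover have "\<B> \<subseteq> Sigma_algebra n" by (auto simp: \<B>_def)
  ultimately show "\<exists>\<B> \<subseteq> Sigma_algebra n. C = {s \<in> Sigma_n n. \<forall>F\<in>\<B>. F s = 0}" by blast
qed

end
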